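(* For all integers $n\geq 0$ and $m\geq 4$, \[ B_{27,11}\left(3^m n+\frac{5\cdot 3^{m-1}-3}{2}\right)\equiv 0\pmod{11}. \]
   Context: For integers $s,t>1$, an $(s,t)$-regular bipartition of $n$ is a pair $(\lambda,\mu)$ of partitions with total sum of parts $n$ such that no part of $\lambda$ is divisible by $s$ and no part of $\mu$ is divisible by $t$. $B_{s,t}(n)$ denotes the number of $(s,t)$-regular bipartitions of $n$; equivalently $\sum_{n\geq0}B_{s,t}(n)q^n=\frac{f_sf_t}{f_1^2}$, where $f_k=\prod_{m\geq1}(1-q^{mk})$. *)

theory Defs
  imports "HOL-Number_Theory.Cong" "HOL-Library.Multiset"
begin

text \<open>A partition is the finite multiset of its (positive) parts; its size is the sum of
  the parts.  The empty multiset is the partition of 0.\<close>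

definition is_partition :: "nat multiset \<Rightarrow> bool" where
  "is_partition \<alpha> \<longleftrightarrow> (\<forall>p \<in># \<alpha>. p > 0)"

definition regular :: "nat \<Rightarrow> nat multiset \<Rightarrow> bool" where
  "regular s \<alpha> \<longleftrightarrow> (\<forall>p \<in># \<alpha>. \<not> s dvd p)"

definition regular_bipartitions :: "nat \<Rightarrow> nat \<Rightarrow> nat \<Rightarrow> (nat multiset \<times> nat multiset) set" where
  "regular_bipartitions s t n =
     {(\<alpha>, \<beta>). is_partition \<alpha> \<and> is_partition \<beta> \<and> sum_mset \<alpha> + sum_mset \<beta> = n \<and> regular s \<alpha> \<and> regular t \<beta>}"

definition B :: "nat \<Rightarrow> nat \<Rightarrow> nat \<Rightarrow> nat" where
  "B s t n = card (regular_bipartitions s t n)"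

text \<open>The set being counted is finite, so \<^const>\<open>card\<close> is not a default value.\<close>

lemma partition_size_le: "is_partition \<alpha> \<Longrightarrow> size \<alpha> \<le> sum_mset \<alpha>"
  by (induction \<alpha>) (auto simp: is_partition_def)

lemma partition_part_le: "p \<in># \<alpha> \<Longrightarrow> p \<le> sum_mset (\<alpha> :: nat multiset)"
  by (metis le_add1 multi_member_split sum_mset.add_mset)

lemma finite_partitions_le: "finite {\<alpha>. is_partition \<alpha> \<and> sum_mset \<alpha> \<le> n}"
proof (rule finite_subset)
  show "finite (mset ` {xs. set xs \<subseteq> {..n} \<and> length xs \<le> n})"
    by (intro finite_imageI finite_lists_length_le) auto
  show "{\<alpha>. is_partition \<alpha> \<and> sum_mset \<alpha> \<le> n} \<subseteq> mset ` {xs. set xs \<subseteq> {..n} \<and> length xs \<le> n}"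
  proof
    fix \<alpha> assume *: "\<alpha> \<in> {\<alpha>. is_partition \<alpha> \<and> sum_mset \<alpha> \<le> n}"
    obtain xs where xs: "mset xs = \<alpha>"
      using ex_mset by blast
    have "set xs \<subseteq> {..n}"
    proof
      fix p assume "p \<in> set xs"
      then have "p \<in># \<alpha>" using xs by auto
      then show "p \<in> {..n}" using partition_part_le[of p \<alpha>] * by simp
    qed
    moreover have "length xs \<le> n"
      using partition_size_le[of \<alpha>] * size_mset[of xs] xs by simp
    ultimately show "\<alpha> \<in> mset ` {xs. set xs \<subseteq> {..n} \<and> length xs \<le> n}"
      using xs by blast
  qed
qed

lemma finite_regular_bipartitions: "finite (regular_bipartitions s t n)"
  by (rule finite_subset[OF _ finite_cartesian_product[OF
        finite_partitions_le[of n] finite_partitions_le[of n]]])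
     (auto simp: regular_bipartitions_def)

end

(* Write f = f_1, F = f(q^3), G = f(q^9). Modulo 11 we have f_11 = f^11, so B_{27,11} has generating
   function f^9 f_27. Jacobi's series for f^3 shows that f^3 = p - 3t with p = P(q^3), t = q G^3.
   Taking the product over q, w q, w^2 q for a cube root of unity w gives P^3 - 27 q F^9 = f^12 / F^3,
   and with the same relation at q^3 this yields P F = f (p + 6t). (In Borwein's notation P / f = a(q)
   and 3 q^(1/3) F^3 / f = c(q); the two relations are a^3 = b^3 + c^3 and a(q) = a(q^3) + 2 c(q^3).)
   Hence W = f P^2 F^3 equals F (p - 3t)(p + 6t)^2, which has no p t^2 term: its coefficients at 3n + 2
   vanish, and those at 3n + 1 are 9 times those at n. Three dissections of f^9 f_27 give -135 W as
   the series of the coefficients at 27n + 12. Since 66 = 27 * 2 + 12, the case m = 4 is the vanishing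
   at 3n + 2, and the factor 9 carries it from m to m + 1. *)
theory Submission
  imports Defs "HOL-Computational_Algebra.Formal_Laurent_Series"
begin

section \<open>Equality of power series up to a given degree\<close>

text \<open>Congruence modulo q^(n+1). It stands in for limits: infinite products and sums are
  compared with finite truncations, one degree bound at a time, and \<open>fps_eqI_upto\<close>
  returns to equality.\<close>

definition eq_upto :: "nat \<Rightarrow> 'a::comm_ring_1 fps \<Rightarrow> 'a fps \<Rightarrow> bool" where
  "eq_upto n g h \<longleftrightarrow> (\<forall>k\<le>n. fps_nth g k = fps_nth h k)"

lemma eq_upto_refl [simp]: "eq_upto n g g"
  by (simp add: eq_upto_def)

lemma eq_upto_sym: "eq_upto n g h \<Longrightarrow> eq_upto n h g"
  by (simp add: eq_upto_def)

lemma eq_upto_trans [trans]: "eq_upto n g h \<Longrightarrow> eq_upto n h k \<Longrightarrow> eq_upto n g k"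
  by (simp add: eq_upto_def)

lemma eq_upto_mult: "eq_upto n g h \<Longrightarrow> eq_upto n g' h' \<Longrightarrow> eq_upto n (g * g') (h * h')"
  by (auto simp: eq_upto_def fps_mult_nth intro!: sum.cong)

lemma eq_upto_add: "eq_upto n g h \<Longrightarrow> eq_upto n g' h' \<Longrightarrow> eq_upto n (g + g') (h + h')"
  by (simp add: eq_upto_def)

lemma eq_upto_diff: "eq_upto n g h \<Longrightarrow> eq_upto n g' h' \<Longrightarrow> eq_upto n (g - g') (h - h')"
  by (simp add: eq_upto_def)

lemma eq_upto_power: "eq_upto n g h \<Longrightarrow> eq_upto n (g ^ k) (h ^ k)"
  by (induction k) (auto intro: eq_upto_mult)

lemma eq_upto_sum: "(\<And>i. i \<in> A \<Longrightarrow> eq_upto n (g i) (h i)) \<Longrightarrow> eq_upto n (sum g A) (sum h A)"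
  by (auto simp: eq_upto_def fps_sum_nth intro!: sum.cong)

lemma fps_eqI_upto: "(\<And>n. eq_upto n g h) \<Longrightarrow> g = h"
  by (auto simp: eq_upto_def fps_eq_iff)

lemma eq_upto_X_power: "n < m \<Longrightarrow> eq_upto n (fps_X ^ m * g) 0"
  by (auto simp: eq_upto_def fps_X_power_mult_nth)

lemma eq_upto_cancel:
  fixes u :: "'a::comm_ring_1 fps"
  assumes "fps_nth u 0 = 1" "eq_upto n (u * g) (u * h)"
  shows "eq_upto n g h"
proof -
  obtain v where v: "u * v = 1"
    using fps_right_inverse[of u 1] assms(1) by (metis mult_1)
  have "v * (u * g) = g" for g
    using v by (metis mult.assoc mult.commute mult_1)
  then show ?thesis
    using eq_upto_mult[OF eq_upto_refl assms(2), of v] by simp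
qed

section \<open>The substitution of q^k for q\<close>

definition dilate :: "nat \<Rightarrow> 'a::comm_ring_1 fps \<Rightarrow> 'a fps" where
  "dilate k g = fps_compose g (fps_X ^ k)"

lemma dilate_nth: "k > 0 \<Longrightarrow> fps_nth (dilate k g) n = (if k dvd n then fps_nth g (n div k) else 0)"
  by (simp add: dilate_def fps_nth_compose_X_power)

lemma eq_upto_dilate: "k > 0 \<Longrightarrow> eq_upto n g h \<Longrightarrow> eq_upto n (dilate k g) (dilate k h)"
  by (auto simp: eq_upto_def dilate_nth) (meson div_le_dividend le_trans)

lemma dilate_1 [simp]: "k > 0 \<Longrightarrow> dilate k 1 = 1"
  by (simp add: dilate_def)

lemma dilate_0 [simp]: "k > 0 \<Longrightarrow> dilate k 0 = 0"
  by (simp add: dilate_def)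

lemma dilate_add: "dilate k (g + h) = dilate k g + dilate k h"
  by (simp add: dilate_def fps_compose_add_distrib)

lemma dilate_diff: "dilate k (g - h) = dilate k g - dilate k h"
  by (simp add: dilate_def fps_compose_sub_distrib)

lemma dilate_uminus: "dilate k (- h) = - dilate k h"
  by (simp add: dilate_def fps_compose_uminus)

lemma dilate_mult: "k > 0 \<Longrightarrow> dilate k (g * h) = dilate k g * dilate k (h :: 'a::idom fps)"
  by (simp add: dilate_def fps_compose_mult_distrib)

lemma dilate_power: "k > 0 \<Longrightarrow> dilate k (g ^ n) = dilate k (g :: 'a::idom fps) ^ n"
  by (induction n) (auto simp: dilate_mult)

lemma dilate_prod: "k > 0 \<Longrightarrow> dilate k (\<Prod>i\<in>I. g i) = (\<Prod>i\<in>I. dilate k (g i :: 'a::idom fps))"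
  by (induction I rule: infinite_finite_induct) (auto simp: dilate_mult)

lemma dilate_X: "k > 0 \<Longrightarrow> dilate k fps_X = fps_X ^ k"
  by (simp add: dilate_def)

lemma dilate_X_power: "k > 0 \<Longrightarrow> dilate k (fps_X ^ n :: 'a::idom fps) = fps_X ^ (k * n)"
  by (simp add: dilate_power dilate_X power_mult)

lemma dilate_numeral: "k > 0 \<Longrightarrow> dilate k (numeral w) = (numeral w :: 'a::idom fps)"
  by (rule fps_ext) (auto simp: dilate_nth fps_numeral_nth)

lemma dilate_of_nat: "k > 0 \<Longrightarrow> dilate k (of_nat n) = (of_nat n :: 'a::idom fps)"
  by (induction n) (auto simp: dilate_add)

lemma dilate_dilate: "j > 0 \<Longrightarrow> k > 0 \<Longrightarrow> dilate j (dilate k g) = dilate (j * k) g"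
  by (rule fps_ext) (auto simp: dilate_nth div_mult2_eq)

lemma dilate_exI:
  assumes "k > 0" "\<And>n. \<not> k dvd n \<Longrightarrow> fps_nth g n = 0"
  shows "\<exists>P. g = dilate k P"
  using assms
  by (intro exI[of _ "Abs_fps (\<lambda>n. fps_nth g (k * n))"] fps_ext) (auto simp: dilate_nth)

section \<open>Euler's product and Jacobi's series for its cube\<close>

definition q_fact :: "nat \<Rightarrow> int fps" where
  "q_fact n = (\<Prod>m\<in>{1..n}. 1 - fps_X ^ m)"

lemma q_fact_0 [simp]: "q_fact 0 = 1"
  by (simp add: q_fact_def)

lemma q_fact_Suc: "q_fact (Suc n) = q_fact n * (1 - fps_X ^ Suc n)"
  by (simp add: q_fact_def)

lemma q_fact_nth_0 [simp]: "fps_nth (q_fact n) 0 = 1"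
  by (induction n) (auto simp: q_fact_Suc)

lemma q_fact_neq_0 [simp]: "q_fact n \<noteq> 0"
  using q_fact_nth_0[of n] by force

text \<open>This is f_1. The factors 1 - q^m with m > n leave coefficient n unchanged, so the
  diagonal of the finite products yields the infinite product.\<close>

definition euler :: "int fps" where
  "euler = Abs_fps (\<lambda>n. fps_nth (q_fact n) n)"

lemma q_fact_stable: "n \<le> m \<Longrightarrow> eq_upto n (q_fact m) (q_fact n)"
proof (induction m rule: dec_induct)
  case base
  show ?case by simp
next
  case (step m)
  have "eq_upto n (q_fact m - fps_X ^ Suc m * q_fact m) (q_fact n - 0)"
    using step by (intro eq_upto_diff eq_upto_X_power) auto
  then show ?case by (simp add: q_fact_Suc algebra_simps)
qed

lemma euler_eq_upto: "n \<le> m \<Longrightarrow> eq_upto n euler (q_fact m)"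
  unfolding eq_upto_def
proof (intro allI impI)
  fix k assume "n \<le> m" "k \<le> n"
  then show "fps_nth euler k = fps_nth (q_fact m) k"
    using q_fact_stable[of k m] by (simp add: euler_def eq_upto_def)
qed

lemma euler_nth_0 [simp]: "fps_nth euler 0 = 1"
  by (simp add: euler_def)

text \<open>The coefficient of \<open>z\<^sup>k\<close> in the finite triple product
  \<open>\<Prod>\<^bsub>0\<le>j\<le>n\<^esub> (1 - q\<^sup>j / z) * \<Prod>\<^bsub>1\<le>j\<le>n\<^esub> (1 - q\<^sup>j z)\<close>. The coefficients of \<open>z\<^sup>k\<close> and
  of \<open>z\<close> to the power \<open>- 1 - k\<close> are opposite, so \<open>k \<ge> 0\<close> suffices.\<close>

fun jtp :: "nat \<Rightarrow> nat \<Rightarrow> int fps" where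
  "jtp 0 k = (if k = 0 then 1 else 0)"
| "jtp (Suc n) 0 = (1 + fps_X ^ (2 * n + 2)) * jtp n 0 - fps_X ^ Suc n * (jtp n 1 - jtp n 0)"
| "jtp (Suc n) (Suc k) =
     (1 + fps_X ^ (2 * n + 2)) * jtp n (Suc k) - fps_X ^ Suc n * (jtp n k + jtp n (Suc (Suc k)))"

lemma jtp_eq_0: "k > n \<Longrightarrow> jtp n k = 0"
  by (induction n k rule: jtp.induct) auto

definition theta_term :: "nat \<Rightarrow> int fps" where
  "theta_term k = (-1) ^ k * fps_X ^ (k * (k + 1) div 2)"

lemma theta_term_0 [simp]: "theta_term 0 = 1"
  by (simp add: theta_term_def)

lemma theta_term_Suc: "theta_term (Suc k) = - (fps_X ^ Suc k * theta_term k)"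
proof -
  have "Suc k * (Suc k + 1) div 2 = k * (k + 1) div 2 + Suc k"
    by simp
  then show ?thesis
    by (simp only: theta_term_def power_add) simp
qed

text \<open>The recurrence of \<open>jtp\<close> after clearing denominators, with x = q, s =
  q^(n-k) and w = q^k; used in \<open>jtp_explicit\<close>.\<close>

lemma jtp_step_identity:
  fixes w s x :: "'a::comm_ring_1"
  shows "(1 + w\<^sup>2 * s\<^sup>2 * x\<^sup>2) * ((1 - s * x) * (1 - w\<^sup>2 * s * x\<^sup>2))
      + s * x * ((1 - w\<^sup>2 * s * x) * (1 - w\<^sup>2 * s * x\<^sup>2))
      + w * s * x * (w * x * ((1 - s) * (1 - s * x)))
    = (1 - w\<^sup>2 * s\<^sup>2 * x\<^sup>2) * (1 - w\<^sup>2 * s\<^sup>2 * x ^ 3)"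
  by (simp add: algebra_simps power2_eq_square power3_eq_cube)

text \<open>Finite triple product: \<open>jtp n k\<close> is \<open>theta_term k\<close> times the
  Gaussian binomial coefficient of 2n+1 over n-k, stated without division. Each term of the
  recurrence is brought over the common denominator \<open>D\<close>.\<close>

lemma jtp_explicit:
  "k \<le> n \<Longrightarrow> q_fact (n - k) * q_fact (n + k + 1) * jtp n k = theta_term k * q_fact (2 * n + 1)"
proof (induction n arbitrary: k)
  case 0
  then show ?case by simp
next
  case (Suc n)
  show ?case
  proof (cases "k = Suc n")
    case True
    have "jtp n n = theta_term n"
      using Suc.IH[of n] by (simp add: mult.commute flip: mult_2)
    then show ?thesis
      using True by (simp add: jtp_eq_0 theta_term_Suc mult_ac flip: mult_2 del: power_Suc)
  next
    case False
    then obtain r where n: "n = k + r"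
      using Suc.prems le_Suc_ex[of k n] by auto
    define D where "D = q_fact (Suc r) * q_fact (Suc (n + k + 1))"
    define Q where "Q = q_fact (2 * n + 1)"
    \<comment> \<open>The coefficient of z^(k-1). For k = 0 this is the one of 1/z, which is minus
      the constant one.\<close>
    define p where "p = (if k = 0 then - jtp n 0 else jtp n (k - 1))"
    have rec: "jtp (Suc n) k =
        (1 + fps_X ^ (2 * n + 2)) * jtp n k - fps_X ^ Suc n * (p + jtp n (Suc k))"
      by (cases k) (auto simp: p_def)
    have A: "D * jtp n k =
        theta_term k * Q * ((1 - fps_X ^ Suc r) * (1 - fps_X ^ Suc (n + k + 1)))"
    proof -
      have "D * jtp n k = (q_fact r * q_fact (n + k + 1) * jtp n k)
          * ((1 - fps_X ^ Suc r) * (1 - fps_X ^ Suc (n + k + 1)))"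
        unfolding D_def q_fact_Suc[of r] q_fact_Suc[of "n + k + 1"] by (simp only: mult_ac)
      also have "q_fact r * q_fact (n + k + 1) * jtp n k = theta_term k * Q"
        using Suc.IH[of k] by (simp add: n Q_def)
      finally show ?thesis .
    qed
    have C: "D * jtp n (Suc k) =
        - (fps_X ^ Suc k * theta_term k * Q * ((1 - fps_X ^ r) * (1 - fps_X ^ Suc r)))"
    proof (cases r)
      case 0
      then show ?thesis by (simp add: n jtp_eq_0)
    next
      case (Suc r')
      have "D * jtp n (Suc k) =
          (q_fact r' * q_fact (n + k + 2) * jtp n (Suc k)) * ((1 - fps_X ^ r) * (1 - fps_X ^ Suc r))"
        unfolding D_def Suc q_fact_Suc[of "Suc r'"] q_fact_Suc[of r'] by (simp add: mult_ac del: power_Suc)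
      also have "q_fact r' * q_fact (n + k + 2) * jtp n (Suc k) = theta_term (Suc k) * Q"
        using Suc.IH[of "Suc k"] by (simp add: n Suc Q_def)
      finally show ?thesis by (simp add: theta_term_Suc mult_ac del: power_Suc)
    qed
    \<comment> \<open>The factor q^k turns \<open>theta_term (k - 1)\<close> into
      \<open>- theta_term k\<close>, so no negative powers of q arise.\<close>
    have B: "D * (fps_X ^ k * p) =
        - (theta_term k * Q * ((1 - fps_X ^ (n + k + 1)) * (1 - fps_X ^ Suc (n + k + 1))))"
    proof (cases k)
      case 0
      then show ?thesis using A by (simp add: p_def n del: power_Suc)
    next
      case (Suc j)
      have "D * (fps_X ^ k * p) = fps_X ^ k * (q_fact (Suc r) * q_fact (n + k) * jtp n j)
          * ((1 - fps_X ^ (n + k + 1)) * (1 - fps_X ^ Suc (n + k + 1)))"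
        unfolding D_def p_def q_fact_Suc[of "n + k + 1"]
        using q_fact_Suc[of "n + k"] by (simp add: Suc mult_ac del: power_Suc)
      also have "q_fact (Suc r) * q_fact (n + k) * jtp n j = theta_term j * Q"
        using Suc.IH[of j] by (simp add: n Suc Q_def)
      finally show ?thesis by (simp add: Suc theta_term_Suc mult_ac del: power_Suc)
    qed
    define x s w where "x = (fps_X :: int fps)" and "s = (fps_X :: int fps) ^ r"
      and "w = (fps_X :: int fps) ^ k"
    have pow: "fps_X ^ m = w ^ i * s ^ j * x ^ l" if "m = k * i + r * j + l" for m i j l
      using that by (simp only: x_def s_def w_def power_add power_mult)
    have pw: "fps_X ^ Suc n = w * s * x" "fps_X ^ Suc r = s * x" "fps_X ^ Suc k = w * x"
      "fps_X ^ (n + k + 1) = w ^ 2 * s * x" "fps_X ^ Suc (n + k + 1) = w ^ 2 * s * x ^ 2"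
      "fps_X ^ (2 * n + 2) = w ^ 2 * s ^ 2 * x ^ 2"
      "fps_X ^ (2 * n + 3) = w ^ 2 * s ^ 2 * x ^ 3"
      using pow[of "Suc n" 1 1 1] pow[of "Suc r" 0 1 1] pow[of "Suc k" 1 0 1]
        pow[of "n + k + 1" 2 1 1] pow[of "Suc (n + k + 1)" 2 1 2]
        pow[of "2 * n + 2" 2 2 2] pow[of "2 * n + 3" 2 2 3]
      by (simp_all add: n del: power_Suc)
    have "D * jtp (Suc n) k = (1 + w ^ 2 * s ^ 2 * x ^ 2) * (D * jtp n k)
        - s * x * (D * (w * p)) - w * s * x * (D * jtp n (Suc k))"
      unfolding rec pw by (simp add: algebra_simps)
    also have "\<dots> = theta_term k * Q * ((1 - w ^ 2 * s ^ 2 * x ^ 2) * (1 - w ^ 2 * s ^ 2 * x ^ 3))"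
      unfolding A C B[folded w_def] pw s_def[symmetric] jtp_step_identity[symmetric]
      by (simp add: algebra_simps)
    also have "\<dots> = theta_term k * q_fact (2 * Suc n + 1)"
      using q_fact_Suc[of "2 * n + 2"] q_fact_Suc[of "2 * n + 1"] pw(6,7)
      by (simp add: Q_def numeral_3_eq_3 mult_ac del: power_Suc)
    finally show ?thesis
      by (simp add: D_def n Suc_diff_le)
  qed
qed

text \<open>The derivative of the finite triple product at z = 1. Pairing z^k with z^(-1-k), whose
  coefficients are opposite, gives the weight k + (k+1). On the product side only the vanishing
  factor 1 - 1/z is differentiated, and the others give \<open>q_fact n ^ 2\<close>.\<close>

lemma sum_jtp: "(\<Sum>k\<le>n. of_nat (2 * k + 1) * jtp n k) = q_fact n ^ 2"
proof (induction n)
  case 0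
  show ?case by simp
next
  case (Suc n)
  define c where "c k = (of_nat (2 * k + 1) :: int fps)" for k
  define S where "S m = (\<Sum>k\<le>m. c k * jtp n k)" for m
  have c: "c 0 = 1" "c (Suc m) = c m + 2" for m
    by (simp_all add: c_def)
  have S: "S n = q_fact n ^ 2"
    using Suc by (simp only: S_def c_def)
  define y where "y = (fps_X :: int fps) ^ Suc n"
  have y: "fps_X ^ (2 * n + 2) = y\<^sup>2"
    by (simp add: y_def power2_eq_square flip: power_add)
  have rec: "jtp (Suc n) 0 = (1 + y\<^sup>2) * jtp n 0 - y * (jtp n (Suc 0) - jtp n 0)"
    "jtp (Suc n) (Suc k) = (1 + y\<^sup>2) * jtp n (Suc k) - y * (jtp n k + jtp n (Suc (Suc k)))" for k
    unfolding y[symmetric] by (simp_all add: y_def del: power_Suc)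
  \<comment> \<open>The weights are linear in k, so c(k-1) + c(k+1) = 2 c(k) and the neighbour terms
    of the recurrence collapse to a boundary term, which vanishes at m = n+1.\<close>
  have key: "(\<Sum>k\<le>m. c k * jtp (Suc n) k)
      = (1 - y)\<^sup>2 * S m + y * ((c m + 2) * jtp n m - c m * jtp n (Suc m))" for m
  proof (induction m)
    case 0
    show ?case
      by (simp add: S_def rec c power2_eq_square algebra_simps del: jtp.simps)
  next
    case (Suc m)
    have "S (Suc m) = S m + (c m + 2) * jtp n (Suc m)"
      by (simp add: S_def c)
    then show ?case
      unfolding sum.atMost_Suc Suc rec c
      by (simp add: power2_eq_square algebra_simps)
  qed
  have "(\<Sum>k\<le>Suc n. c k * jtp (Suc n) k) = (1 - y)\<^sup>2 * S (Suc n)"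
    unfolding key by (simp add: jtp_eq_0)
  also have "S (Suc n) = S n"
    by (simp add: S_def jtp_eq_0)
  finally show ?case
    unfolding S q_fact_Suc y_def c_def by (simp only: power_mult_distrib mult.commute)
qed

text \<open>If n-k is at least N, both factors in \<open>jtp_explicit\<close> may be replaced by
  \<open>euler\<close>, and so may \<open>q_fact (2 * n + 1)\<close>. Otherwise k > N, and both
  sides vanish up to degree N.\<close>

lemma jtp_limit:
  assumes "2 * N \<le> n" "k \<le> n"
  shows "eq_upto N (euler * jtp n k) (theta_term k)"
proof (cases "N \<le> n - k")
  case True
  have "eq_upto N (euler * euler * jtp n k) (q_fact (n - k) * q_fact (n + k + 1) * jtp n k)"
    using assms True by (intro eq_upto_mult euler_eq_upto) auto
  also have "q_fact (n - k) * q_fact (n + k + 1) * jtp n k = theta_term k * q_fact (2 * n + 1)"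
    by (rule jtp_explicit) fact
  also have "eq_upto N \<dots> (theta_term k * euler)"
    using assms by (intro eq_upto_mult eq_upto_sym[OF euler_eq_upto]) auto
  finally have "eq_upto N (euler * (euler * jtp n k)) (euler * theta_term k)"
    by (simp only: mult_ac)
  then show ?thesis
    by (rule eq_upto_cancel[OF euler_nth_0])
next
  case False
  have "N < k"
    using False assms by linarith
  also have "k \<le> k * (k + 1) div 2"
    by (induction k) auto
  finally have theta: "eq_upto N (theta_term k) 0"
    using eq_upto_X_power[of N "k * (k + 1) div 2" "(-1) ^ k"]
    by (simp add: theta_term_def mult.commute)
  have "eq_upto N (q_fact (2 * n + 1) * theta_term k) (q_fact (2 * n + 1) * 0)"
    by (intro eq_upto_mult theta eq_upto_refl)
  then have "eq_upto N (q_fact (n - k) * q_fact (n + k + 1) * jtp n k) (q_fact (n - k) * q_fact (n + k + 1) * 0)"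
    using jtp_explicit[OF assms(2)] by (simp add: mult.commute)
  then have "eq_upto N (jtp n k) 0"
    by (rule eq_upto_cancel[rotated]) simp
  then have "eq_upto N (euler * jtp n k) (euler * 0)"
    by (intro eq_upto_mult eq_upto_refl)
  then show ?thesis
    using eq_upto_trans[OF _ eq_upto_sym[OF theta]] by simp
qed

definition theta_sum :: "nat \<Rightarrow> int fps" where
  "theta_sum n = (\<Sum>k<n. of_nat (2 * k + 1) * theta_term k)"

text \<open>Jacobi's series for f^3: multiply \<open>sum_jtp\<close> by \<open>euler\<close> and
  pass to the limit termwise with \<open>jtp_limit\<close>.\<close>

lemma jacobi_cube:
  assumes "2 * N < n"
  shows "eq_upto N (euler ^ 3) (theta_sum n)"
proof -
  obtain n' where n': "n = Suc n'" "2 * N \<le> n'"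
    using assms by (cases n) auto
  have "eq_upto N (euler ^ 3) (euler * q_fact n' ^ 2)"
    unfolding power3_eq_cube power2_eq_square mult.assoc
    using n' by (intro eq_upto_mult euler_eq_upto eq_upto_refl) auto
  also have "euler * q_fact n' ^ 2 = (\<Sum>k\<le>n'. of_nat (2 * k + 1) * (euler * jtp n' k))"
    unfolding sum_jtp[symmetric] sum_distrib_left by (intro sum.cong) (simp_all only: mult_ac)
  also have "eq_upto N \<dots> (\<Sum>k\<le>n'. of_nat (2 * k + 1) * theta_term k)"
    using n' by (intro eq_upto_sum eq_upto_mult eq_upto_refl jtp_limit) auto
  also have "\<dots> = theta_sum n"
    by (simp only: theta_sum_def n' lessThan_Suc_atMost)
  finally show ?thesis .
qed

section \<open>The 3-dissection of Jacobi's series\<close>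

text \<open>The triangular number T(k) is divisible by 3 unless k = 1 modulo 3, and T(3k+1) = 9 T(k)
  + 1.\<close>

lemma theta_term_trisect:
  "\<exists>P. theta_term (3 * k) = dilate 3 P"
  "theta_term (3 * k + 1) = - (fps_X * dilate 3 (dilate 3 (theta_term k)))"
  "\<exists>P. theta_term (3 * k + 2) = dilate 3 P"
proof -
  have sgn: "dilate 3 ((-1) ^ k * fps_X ^ m :: int fps) = (-1) ^ k * fps_X ^ (3 * m)" for m and k :: nat
    by (simp only: dilate_mult dilate_X dilate_power dilate_uminus dilate_1 power_mult zero_less_numeral)
  have "2 dvd k * (k + 1)"
    by simp
  then obtain t where t: "k * (k + 1) = 2 * t" ..
  have sgn3: "(-1) ^ (3 * k) = ((-1) ^ k :: int fps)" "(-1) ^ (3 * k + 2) = ((-1) ^ k :: int fps)"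
    "(-1) ^ (3 * k + 1) = - ((-1) ^ k :: int fps)"
    by (simp_all add: power_mult)
  have "3 * k * (3 * k + 1) div 2 = 3 * (k * k + t)"
    using t by (simp add: algebra_simps)
  then have "theta_term (3 * k) = dilate 3 ((-1) ^ k * fps_X ^ (k * k + t))"
    by (simp only: theta_term_def sgn sgn3)
  then show "\<exists>P. theta_term (3 * k) = dilate 3 P" ..
  have "(3 * k + 1) * (3 * k + 1 + 1) div 2 = Suc (3 * (3 * t))"
    using t by (simp add: algebra_simps)
  moreover have "k * (k + 1) div 2 = t"
    by (simp only: t)
  ultimately show "theta_term (3 * k + 1) = - (fps_X * dilate 3 (dilate 3 (theta_term k)))"
    by (simp only: theta_term_def sgn sgn3 power_Suc mult_minus_left mult_minus_right mult.left_commute)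
  have "(3 * k + 2) * (3 * k + 2 + 1) div 2 = 3 * (k * k + t + 2 * k + 1)"
    using t by (simp add: algebra_simps)
  then have "theta_term (3 * k + 2) = dilate 3 ((-1) ^ k * fps_X ^ (k * k + t + 2 * k + 1))"
    by (simp only: theta_term_def sgn sgn3)
  then show "\<exists>P. theta_term (3 * k + 2) = dilate 3 P" ..
qed

text \<open>The middle terms carry the weight 2(3k+1) + 1 = 3(2k+1). They therefore reproduce the
  whole sum at q^9, with the factor 3q.\<close>

lemma theta_sum_trisect:
  "\<exists>P. theta_sum (3 * M) = dilate 3 P - 3 * fps_X * dilate 3 (dilate 3 (theta_sum M))"
proof (induction M)
  case 0
  have "theta_sum 0 = 0" by (simp add: theta_sum_def)
  then show ?case by (auto intro: exI[of _ 0])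
next
  case (Suc M)
  then obtain P where P: "theta_sum (3 * M) = dilate 3 P - 3 * fps_X * dilate 3 (dilate 3 (theta_sum M))"
    by blast
  obtain P0 P2 where P02: "theta_term (3 * M) = dilate 3 P0" "theta_term (3 * M + 2) = dilate 3 P2"
    using theta_term_trisect by blast
  have S: "theta_sum (Suc n) = theta_sum n + of_nat (2 * n + 1) * theta_term n" for n
    by (simp add: theta_sum_def)
  have ring: "p - 3 * x * t + a * u + 3 * b * (- (x * v)) + c * w = p + a * u + c * w - 3 * x * (t + b * v)"
    for p x t a b c u v w :: "'r::comm_ring_1"
    by (simp add: algebra_simps)
  have "3 * Suc M = Suc (Suc (Suc (3 * M)))"
    by simp
  then have "theta_sum (3 * Suc M) = theta_sum (Suc (Suc (Suc (3 * M))))"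
    by (simp only:)
  also have "\<dots> = theta_sum (3 * M) + of_nat (2 * (3 * M) + 1) * theta_term (3 * M)
      + of_nat (3 * (2 * M + 1)) * theta_term (3 * M + 1) + of_nat (2 * (3 * M + 2) + 1) * theta_term (3 * M + 2)"
    unfolding S by simp
  also have "\<dots> = dilate 3 (P + of_nat (2 * (3 * M) + 1) * P0 + of_nat (2 * (3 * M + 2) + 1) * P2)
      - 3 * fps_X * dilate 3 (dilate 3 (theta_sum (Suc M)))"
    unfolding S P P02 theta_term_trisect(2) of_nat_mult[of 3] of_nat_numeral
    by (simp only: dilate_add dilate_mult dilate_of_nat zero_less_numeral ring)
  finally show ?case by blast
qed

lemma euler_cube_trisect:
  "\<exists>P. euler ^ 3 = dilate 3 P - 3 * fps_X * dilate 3 (dilate 3 euler) ^ 3"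
proof -
  define G where "G = dilate 3 (dilate 3 (euler ^ 3))"
  \<comment> \<open>The series P of \<open>theta_sum_trisect\<close> depends on the truncation. What
    passes to the limit is that the coefficients at non-multiples of 3 vanish.\<close>
  have "fps_nth (euler ^ 3 + 3 * fps_X * G) n = 0" if "\<not> 3 dvd n" for n
  proof -
    define M where "M = Suc (2 * n)"
    obtain P where P: "theta_sum (3 * M) = dilate 3 P - 3 * fps_X * dilate 3 (dilate 3 (theta_sum M))"
      using theta_sum_trisect by blast
    have "eq_upto n (euler ^ 3 + 3 * fps_X * G)
        (theta_sum (3 * M) + 3 * fps_X * dilate 3 (dilate 3 (theta_sum M)))"
      unfolding G_def
      by (intro eq_upto_add eq_upto_mult eq_upto_dilate eq_upto_refl jacobi_cube) (auto simp: M_def)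
    then have "eq_upto n (euler ^ 3 + 3 * fps_X * G) (dilate 3 P)"
      by (simp add: P)
    then show ?thesis
      using that by (simp add: eq_upto_def dilate_nth)
  qed
  then obtain P where "euler ^ 3 + 3 * fps_X * G = dilate 3 P"
    using dilate_exI[of 3] by (metis zero_less_numeral)
  then have "euler ^ 3 = dilate 3 P - 3 * fps_X * G"
    by (simp add: algebra_simps)
  then show ?thesis
    by (auto simp: G_def dilate_power)
qed

section \<open>Sections modulo 3\<close>

definition sec :: "nat \<Rightarrow> 'a::comm_ring_1 fps \<Rightarrow> 'a fps" where
  "sec r g = Abs_fps (\<lambda>n. fps_nth g (3 * n + r))"

lemma sec_nth [simp]: "fps_nth (sec r g) n = fps_nth g (3 * n + r)"
  by (simp add: sec_def)

lemma sec_add: "sec r (g + h) = sec r g + sec r h"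
  by (simp add: fps_eq_iff)

lemma sec_dilate: "sec 0 (dilate 3 g) = g" "sec 1 (dilate 3 g) = 0" "sec 2 (dilate 3 g) = 0"
proof -
  have "\<not> 3 dvd Suc (3 * n)" "\<not> 3 dvd Suc (Suc (3 * n))" for n :: nat
    by presburger+
  then show "sec 0 (dilate 3 g) = g" "sec 1 (dilate 3 g) = 0" "sec 2 (dilate 3 g) = 0"
    by (simp_all add: fps_eq_iff dilate_nth)
qed

lemma sec_X_mult:
  "sec 0 (fps_X * g) = fps_X * sec 2 g" "sec 1 (fps_X * g) = sec 0 g" "sec 2 (fps_X * g) = sec 1 g"
proof -
  have "fps_nth (fps_X * g) (3 * n) = fps_nth (fps_X * sec 2 g) n" for n
    by (cases n) (simp_all del: mult_Suc mult_Suc_right, simp add: numeral_3_eq_3 numeral_2_eq_2)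
  then show "sec 0 (fps_X * g) = fps_X * sec 2 g"
    by (simp add: fps_eq_iff)
  show "sec 1 (fps_X * g) = sec 0 g" "sec 2 (fps_X * g) = sec 1 g"
    by (simp_all add: fps_eq_iff)
qed

lemma sec_trisect:
  fixes x y z :: "'a::comm_ring_1 fps"
  defines "g \<equiv> dilate 3 x + fps_X * dilate 3 y + fps_X\<^sup>2 * dilate 3 z"
  shows "sec 0 g = x" "sec 1 g = y" "sec 2 g = z"
  by (simp_all only: g_def power2_eq_square mult.assoc sec_add sec_X_mult sec_dilate
      mult_zero_right add_0_left add_0_right)

lemma trisect: "g = dilate 3 (sec 0 g) + fps_X * dilate 3 (sec 1 g) + fps_X\<^sup>2 * dilate 3 (sec 2 g)"
proof (rule fps_ext)
  fix n :: nat
  define g' where "g' = dilate 3 (sec 0 g) + fps_X * dilate 3 (sec 1 g) + fps_X\<^sup>2 * dilate 3 (sec 2 g)"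
  have s: "sec 0 g' = sec 0 g" "sec 1 g' = sec 1 g" "sec 2 g' = sec 2 g"
    unfolding g'_def by (rule sec_trisect)+
  have "n mod 3 = 0 \<or> n mod 3 = 1 \<or> n mod 3 = 2"
    by presburger
  then have "sec (n mod 3) g = sec (n mod 3) g'"
    using s by metis
  then have "fps_nth g (3 * (n div 3) + n mod 3) = fps_nth g' (3 * (n div 3) + n mod 3)"
    by (metis sec_nth)
  then show "fps_nth g n = fps_nth g' n"
    by simp
qed

section \<open>The cubic norm and its value on Euler's product\<close>

text \<open>The norm of x + r y + r^2 z, where r is a cube root of \<open>fps_X\<close>. With this
  formula the product over cube roots of unity is expressed in the coefficient ring itself.\<close>

definition norm3_form :: "'a::comm_ring_1 fps \<Rightarrow> 'a fps \<Rightarrow> 'a fps \<Rightarrow> 'a fps" where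
  "norm3_form x y z = x ^ 3 + fps_X * y ^ 3 + fps_X\<^sup>2 * z ^ 3 - 3 * fps_X * x * y * z"

text \<open>The product of \<open>g(\<omega>\<^sup>i q)\<close> over the three cube roots of unity \<open>\<omega>\<^sup>i\<close>, written as a
  series in \<open>q\<^sup>3\<close>.\<close>

definition norm3 :: "'a::comm_ring_1 fps \<Rightarrow> 'a fps" where
  "norm3 g = norm3_form (sec 0 g) (sec 1 g) (sec 2 g)"

lemma norm3_trisect:
  "norm3 (dilate 3 x + fps_X * dilate 3 y + fps_X\<^sup>2 * dilate 3 z) = norm3_form x y z"
  by (simp only: norm3_def sec_trisect)

text \<open>Multiplicativity of the norm: u, v, w are the coordinates of the product in the basis 1,
  r, r^2 with r^3 = t.\<close>

lemma cubic_norm_mult: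
  fixes t x y z x' y' z' :: "'a::comm_ring_1"
  defines "u \<equiv> x * x' + t * (y * z' + z * y')" and "v \<equiv> x * y' + y * x' + t * (z * z')"
    and "w \<equiv> x * z' + y * y' + z * x'"
  shows "(x ^ 3 + t * y ^ 3 + t\<^sup>2 * z ^ 3 - 3 * t * x * y * z)
      * (x' ^ 3 + t * y' ^ 3 + t\<^sup>2 * z' ^ 3 - 3 * t * x' * y' * z')
    = u ^ 3 + t * v ^ 3 + t\<^sup>2 * w ^ 3 - 3 * t * u * v * w"
  unfolding u_def v_def w_def by (simp add: algebra_simps power2_eq_square power3_eq_cube)

lemma trisect_mult:
  fixes t x y z x' y' z' :: "'a::comm_ring_1"
  shows "(x + t * y + t\<^sup>2 * z) * (x' + t * y' + t\<^sup>2 * z')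
    = x * x' + t ^ 3 * (y * z' + z * y') + t * (x * y' + y * x' + t ^ 3 * (z * z'))
      + t\<^sup>2 * (x * z' + y * y' + z * x')"
  by (simp add: algebra_simps power2_eq_square power3_eq_cube)

lemma norm3_form_mult:
  "norm3_form x y z * norm3_form x' y' z' =
    norm3_form (x * x' + fps_X * (y * z' + z * y')) (x * y' + y * x' + fps_X * (z * z'))
      (x * z' + y * y' + z * x')"
  unfolding norm3_form_def by (rule cubic_norm_mult)

lemma norm3_mult: "norm3 (g * h) = norm3 g * norm3 (h :: 'a::idom fps)"
proof -
  define x y z where g: "x = sec 0 g" "y = sec 1 g" "z = sec 2 g"
  define x' y' z' where h: "x' = sec 0 h" "y' = sec 1 h" "z' = sec 2 h"
  have "g * h = (dilate 3 x + fps_X * dilate 3 y + fps_X\<^sup>2 * dilate 3 z)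
      * (dilate 3 x' + fps_X * dilate 3 y' + fps_X\<^sup>2 * dilate 3 z')"
    unfolding g h using trisect by metis
  also have "\<dots> = dilate 3 (x * x' + fps_X * (y * z' + z * y'))
      + fps_X * dilate 3 (x * y' + y * x' + fps_X * (z * z'))
      + fps_X\<^sup>2 * dilate 3 (x * z' + y * y' + z * x')"
    by (simp only: dilate_add dilate_mult dilate_X zero_less_numeral trisect_mult)
  finally show ?thesis
    by (simp only: norm3_trisect norm3_form_mult[symmetric]) (simp only: norm3_def g h)
qed

lemma norm3_1 [simp]: "norm3 1 = (1 :: 'a::idom fps)"
  using norm3_trisect[of 1 0 0] by (simp add: norm3_form_def)

lemma norm3_power: "norm3 (g ^ n) = norm3 (g :: 'a::idom fps) ^ n"
  by (induction n) (auto simp: norm3_mult)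

text \<open>The product of 1 - (w^i q)^m over the three cube roots of unity w^i is (1 - q^m)^3 if 3
  divides m and 1 - q^(3m) otherwise; then q^3 is renamed q.\<close>

lemma norm3_one_minus_X_power:
  "norm3 (1 - fps_X ^ (3 * k)) = (1 - fps_X ^ k :: 'a::idom fps) ^ 3"
  "norm3 (1 - fps_X ^ Suc (3 * k)) = (1 - fps_X ^ Suc (3 * k) :: 'a::idom fps)"
  "norm3 (1 - fps_X ^ Suc (Suc (3 * k))) = (1 - fps_X ^ Suc (Suc (3 * k)) :: 'a fps)"
proof -
  have p: "((fps_X :: 'a fps) ^ k) ^ 3 = fps_X ^ (3 * k)"
    by (simp only: power_mult[symmetric] mult.commute)
  have d: "dilate 3 (fps_X ^ k :: 'a fps) = fps_X ^ (3 * k)"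
    by (simp only: dilate_X_power zero_less_numeral)
  show "norm3 (1 - fps_X ^ (3 * k)) = (1 - fps_X ^ k :: 'a::idom fps) ^ 3"
    using norm3_trisect[of "1 - fps_X ^ k :: 'a fps" 0 0]
    by (simp add: dilate_diff d norm3_form_def)
  show "norm3 (1 - fps_X ^ Suc (3 * k)) = (1 - fps_X ^ Suc (3 * k) :: 'a::idom fps)"
    using norm3_trisect[of "1::'a fps" "- (fps_X ^ k)" 0]
    by (simp add: dilate_uminus d norm3_form_def p power_minus_odd)
  show "norm3 (1 - fps_X ^ Suc (Suc (3 * k))) = (1 - fps_X ^ Suc (Suc (3 * k)) :: 'a fps)"
    using norm3_trisect[of "1::'a fps" 0 "- (fps_X ^ k)"]
    by (simp add: dilate_uminus d norm3_form_def p power2_eq_square mult.assoc power_minus_odd)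
qed

text \<open>Factors with exponent prime to 3 are their own norms. The factors with exponent
  divisible by 3, which would complete them to \<open>q_fact (3 * n)\<close>, make up
  \<open>dilate 3 (q_fact n)\<close>.\<close>

lemma norm3_q_fact: "norm3 (q_fact (3 * n)) * dilate 3 (q_fact n) = q_fact (3 * n) * q_fact n ^ 3"
proof (induction n)
  case 0
  then show ?case by simp
next
  case (Suc n)
  define u v :: "int fps" where "u = 1 - fps_X ^ Suc (3 * n)" and "v = 1 - fps_X ^ Suc (Suc (3 * n))"
  have n3: "3 * Suc n = Suc (Suc (Suc (3 * n)))"
    by simp
  have q: "q_fact (3 * Suc n) = q_fact (3 * n) * u * v * (1 - fps_X ^ (3 * Suc n))"
    unfolding u_def v_def n3 q_fact_Suc by (rule refl)
  have d: "dilate 3 (q_fact (Suc n)) = dilate 3 (q_fact n) * (1 - fps_X ^ (3 * Suc n))"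
    unfolding q_fact_Suc by (simp add: dilate_mult dilate_diff dilate_X_power del: power_Suc)
  have uv: "norm3 u = u" "norm3 v = v"
    unfolding u_def v_def by (rule norm3_one_minus_X_power)+
  have "norm3 (q_fact (3 * Suc n)) * dilate 3 (q_fact (Suc n))
      = (norm3 (q_fact (3 * n)) * dilate 3 (q_fact n))
        * (u * v * (1 - fps_X ^ Suc n) ^ 3 * (1 - fps_X ^ (3 * Suc n)))"
    unfolding q d norm3_mult norm3_one_minus_X_power uv by (simp only: mult_ac)
  then show ?case
    unfolding Suc q q_fact_Suc[of n] power_mult_distrib by (simp only: mult_ac)
qed

lemma norm3_euler: "norm3 euler * dilate 3 euler = euler ^ 4"
proof (rule fps_eqI_upto)
  fix n
  \<comment> \<open>Sections up to degree n involve coefficients up to 3n+2, hence the truncation at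
    3(n+1).\<close>
  have sec: "eq_upto n (sec r euler) (sec r (q_fact (3 * (n + 1))))" if "r < 3" for r
    using euler_eq_upto[of "3 * (n + 1)" "3 * (n + 1)"] that by (auto simp: eq_upto_def)
  have "eq_upto n (norm3 euler * dilate 3 euler) (norm3 (q_fact (3 * (n + 1))) * dilate 3 (q_fact (n + 1)))"
    unfolding norm3_def norm3_form_def
    by (intro eq_upto_mult eq_upto_diff eq_upto_add eq_upto_power eq_upto_refl sec eq_upto_dilate
        euler_eq_upto) auto
  also have "\<dots> = q_fact (3 * (n + 1)) * q_fact (n + 1) ^ 3"
    by (rule norm3_q_fact)
  also have "eq_upto n \<dots> (euler * euler ^ 3)"
    by (intro eq_upto_mult eq_upto_power eq_upto_sym[OF euler_eq_upto]) auto
  also have "euler * euler ^ 3 = euler ^ 4"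
    by (simp add: power_numeral_reduce)
  finally show "eq_upto n (norm3 euler * dilate 3 euler) (euler ^ 4)" .
qed

section \<open>The cubic modular relation and the three dissections\<close>

text \<open>The cofactor of u - v in u^3 - v^3 has constant term 3, so it is nonzero.\<close>

lemma fps_cube_eqD:
  fixes u v :: "int fps"
  assumes "u ^ 3 = v ^ 3" "fps_nth u 0 = 1" "fps_nth v 0 = 1"
  shows "u = v"
proof -
  have ring: "(a - b) * (a * a + a * b + b * b) = a ^ 3 - b ^ 3" for a b :: "'r::comm_ring_1"
    by (simp add: algebra_simps power3_eq_cube)
  have "(u - v) * (u * u + u * v + v * v) = 0"
    using assms(1) by (simp only: ring) simp
  moreover have "fps_nth (u * u + u * v + v * v) 0 = 3"
    using assms(2,3) by simp
  then have "u * u + u * v + v * v \<noteq> 0"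
    by force
  ultimately show ?thesis
    by simp
qed

lemma sec_dilate_mult: "sec r (dilate 3 g * h) = g * sec r (h :: 'a::idom fps)" if "r < 3"
proof -
  define x y z where h: "x = sec 0 h" "y = sec 1 h" "z = sec 2 h"
  have "dilate 3 g * h = dilate 3 g * (dilate 3 x + fps_X * dilate 3 y + fps_X\<^sup>2 * dilate 3 z)"
    unfolding h trisect[symmetric] ..
  also have "\<dots> = dilate 3 (g * x) + fps_X * dilate 3 (g * y) + fps_X\<^sup>2 * dilate 3 (g * z)"
    by (simp only: dilate_mult zero_less_numeral distrib_left mult.left_commute)
  finally have *: "dilate 3 g * h = \<dots>" .
  have "sec 0 (dilate 3 g * h) = g * sec 0 h" "sec 1 (dilate 3 g * h) = g * sec 1 h"
    "sec 2 (dilate 3 g * h) = g * sec 2 h"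
    unfolding * sec_trisect h by (rule refl)+
  moreover have "r = 0 \<or> r = 1 \<or> r = 2"
    using that by presburger
  ultimately show ?thesis by metis
qed

lemma dilate3_simps:
  "dilate 3 (g + h) = dilate 3 g + dilate 3 h"
  "dilate 3 (g - h) = dilate 3 g - dilate 3 h"
  "dilate 3 (- g) = - dilate 3 g"
  "dilate 3 (g * h) = dilate 3 g * dilate 3 h"
  "dilate 3 (g ^ n) = dilate 3 g ^ n"
  "dilate 3 (numeral w) = (numeral w :: int fps)"
  "dilate 3 fps_X = (fps_X ^ 3 :: int fps)" for g h :: "int fps"
  by (simp_all only: dilate_add dilate_diff dilate_uminus dilate_mult dilate_power dilate_numeral
      dilate_X zero_less_numeral)

text \<open>With t = x G^3, eliminating P and then F from the left side leaves f^12 + 27 t (p^3 - 27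
  t^3). Since f^3 = p - 3t, this is f^3 times (p - 3t)^3 + 27 t (p^2 + 3 p t + 9 t^2) = (p +
  6t)^3.\<close>

lemma cubic_modular_relation:
  fixes f F G P p x :: "'a::comm_ring_1"
  assumes "f ^ 3 = p - 3 * x * G ^ 3"
    and "(P ^ 3 - 27 * x * F ^ 9) * F ^ 3 = f ^ 12"
    and "(p ^ 3 - 27 * x ^ 3 * G ^ 9) * G ^ 3 = F ^ 12"
  shows "(P * F) ^ 3 = (f * (p + 6 * x * G ^ 3)) ^ 3"
proof -
  have p: "p = f ^ 3 + 3 * x * G ^ 3"
    using assms(1) by simp
  have "(P * F) ^ 3 = (P ^ 3 - 27 * x * F ^ 9) * F ^ 3 + 27 * x * F ^ 12"
    by (simp add: algebra_simps eval_nat_numeral)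
  also have "\<dots> = f ^ 12 + 27 * x * ((p ^ 3 - 27 * x ^ 3 * G ^ 9) * G ^ 3)"
    by (simp only: assms(2,3))
  also have "\<dots> = (f * (p + 6 * x * G ^ 3)) ^ 3"
    unfolding p by (simp add: algebra_simps eval_nat_numeral)
  finally show ?thesis .
qed

lemma W_exists:
  obtains W :: "int fps" where "sec 2 W = 0" "sec 1 W = 9 * W"
    "sec 1 (sec 1 (sec 0 (euler ^ 9 * dilate 27 euler))) = - 135 * W"
proof -
  define f where "f = euler"
  define F where "F = dilate 3 f"
  define G where "G = dilate 3 F"
  obtain P where P: "f ^ 3 = dilate 3 P - 3 * fps_X * G ^ 3"
    using euler_cube_trisect unfolding f_def F_def G_def by blast
  define p where "p = dilate 3 P"
  define x where "x = (fps_X :: int fps)"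
  define W where "W = f * P\<^sup>2 * F ^ 3"
  note d = dilate3_simps[folded x_def] F_def[symmetric] G_def[symmetric] p_def[symmetric]
  have nz: "f \<noteq> 0" "F \<noteq> 0"
    unfolding f_def F_def by (auto simp: fps_eq_iff dilate_nth intro!: exI[of _ 0])
  have e1: "f ^ 3 = p - 3 * x * G ^ 3"
    unfolding P p_def x_def ..
  \<comment> \<open>Compute the norm of f^3 twice: from its trisection with sections P, -3 F^3, 0,
    and from \<open>norm3_euler\<close>.\<close>
  have e2: "(P ^ 3 - 27 * x * F ^ 9) * F ^ 3 = f ^ 12"
  proof -
    have "f ^ 3 = dilate 3 P + x * dilate 3 (- 3 * F ^ 3) + x\<^sup>2 * dilate 3 0"
      unfolding e1 d by simp
    then have "norm3 (f ^ 3) = norm3_form P (- 3 * F ^ 3) 0"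
      by (simp only: x_def norm3_trisect)
    also have "\<dots> = P ^ 3 - 27 * x * F ^ 9"
      by (simp add: norm3_form_def x_def power_mult_distrib flip: power_mult)
    finally have "P ^ 3 - 27 * x * F ^ 9 = norm3 f ^ 3"
      by (simp add: norm3_power)
    then have "(P ^ 3 - 27 * x * F ^ 9) * F ^ 3 = (norm3 f * F) ^ 3"
      by (simp only: power_mult_distrib)
    also have "\<dots> = (f ^ 4) ^ 3"
      by (simp only: norm3_euler f_def F_def)
    finally show ?thesis
      by (simp flip: power_mult)
  qed
  have e3: "(p ^ 3 - 27 * x ^ 3 * G ^ 9) * G ^ 3 = F ^ 12"
    using arg_cong[OF e2, of "dilate 3"] by (simp only: d)
  have e4: "P * F = f * (p + 6 * x * G ^ 3)"
  proof (rule fps_cube_eqD)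
    show "(P * F) ^ 3 = (f * (p + 6 * x * G ^ 3)) ^ 3"
      by (rule cubic_modular_relation[OF e1 e2 e3])
    have "fps_nth (f ^ 3) 0 = 1" "fps_nth f 0 = 1" "fps_nth F 0 = 1"
      by (simp_all add: f_def F_def dilate_nth fps_power_zeroth)
    moreover from this have "fps_nth p 0 = 1"
      unfolding e1 x_def by simp
    moreover have "fps_nth P 0 = fps_nth p 0"
      by (simp add: p_def dilate_nth)
    ultimately show "fps_nth (P * F) 0 = 1" "fps_nth (f * (p + 6 * x * G ^ 3)) 0 = 1"
      by (simp_all add: x_def)
  qed
  define t where "t = x * G ^ 3"
  note e1' = e1[unfolded mult.assoc, folded t_def] and e4' = e4[unfolded mult.assoc, folded t_def]
  have W: "W = F * ((p - 3 * t) * (p + 6 * t)\<^sup>2)"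
  proof -
    have "F * W = f * (P * F)\<^sup>2 * F\<^sup>2"
      unfolding W_def by (simp add: eval_nat_numeral mult_ac)
    also have "\<dots> = F * (F * (f ^ 3 * (p + 6 * t)\<^sup>2))"
      unfolding e4' by (simp add: eval_nat_numeral mult_ac)
    finally show ?thesis
      using nz by (simp add: e1')
  qed
  \<comment> \<open>Expanding, (p - 3t)(p + 6t)^2 = p^3 + 9 p^2 t - 108 t^3. As p is a series in q^3
    and t is q times one, these terms have residues 0, 1, 0, and F p^2 G^3 is W at q^3.\<close>
  have "W = dilate 3 (f * P ^ 3 - 108 * x * f * F ^ 9) + x * dilate 3 (9 * W) + x\<^sup>2 * dilate 3 0"
  proof -
    have ring: "F * ((p - 3 * (x * G ^ 3)) * (p + 6 * (x * G ^ 3))\<^sup>2)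
        = F * p ^ 3 - 108 * x ^ 3 * F * G ^ 9 + x * (9 * (F * p\<^sup>2 * G ^ 3)) + x\<^sup>2 * 0"
      for F p x G :: "'r::comm_ring_1"
      by (simp add: algebra_simps eval_nat_numeral)
    have "dilate 3 (0 :: int fps) = 0"
      by simp
    then show ?thesis
      by (subst W) (simp only: W_def d t_def ring)
  qed
  then have "sec 2 W = 0" "sec 1 W = 9 * W"
    unfolding x_def by (metis sec_trisect)+
  moreover have "sec 1 (sec 1 (sec 0 (euler ^ 9 * dilate 27 euler))) = - 135 * W"
  proof -
    define H where "H = dilate 3 G"
    have H: "dilate 27 f = H"
      by (simp add: H_def G_def F_def dilate_dilate)
    define Y where "Y = G * (P ^ 3 - 27 * x * F ^ 9)"
    have "f ^ 9 * H = dilate 3 Y + x * dilate 3 (- 9 * (G * P\<^sup>2 * F ^ 3)) + x\<^sup>2 * dilate 3 (27 * (G * P * F ^ 6))"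
    proof -
      have ring: "(p - 3 * x * G ^ 3) ^ 3 * H = H * (p ^ 3 - 27 * x ^ 3 * G ^ 9)
          + x * (- 9 * (H * p\<^sup>2 * G ^ 3)) + x\<^sup>2 * (27 * (H * p * G ^ 6))"
        for H p x G :: "'r::comm_ring_1"
        by (simp add: algebra_simps eval_nat_numeral)
      have "f ^ 9 = (f ^ 3) ^ 3"
        by (simp flip: power_mult)
      then show ?thesis
        by (simp only: e1 Y_def d H_def[symmetric] ring)
    qed
    then have Y: "sec 0 (f ^ 9 * H) = Y"
      unfolding x_def by (metis sec_trisect)
    \<comment> \<open>The second dissection is made after multiplying by F^3, a series in q^3: by
      \<open>e2\<close> this turns Y into G f^12, and f^12 = (p - 3t)^4 expands.\<close>
    have "dilate 3 (f ^ 3) * Y = G * f ^ 12"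
      using e2 by (simp only: Y_def d) (simp only: mult_ac)
    also have "\<dots> = dilate 3 (F * (P ^ 4 - 108 * x * P * F ^ 9))
        + x * dilate 3 (F * (81 * x * F ^ 12 - 12 * P ^ 3 * F ^ 3)) + x\<^sup>2 * dilate 3 (54 * (F * P\<^sup>2 * F ^ 6))"
    proof -
      have ring: "G * (p - 3 * x * G ^ 3) ^ 4 = G * (p ^ 4 - 108 * x ^ 3 * p * G ^ 9)
          + x * (G * (81 * x ^ 3 * G ^ 12 - 12 * p ^ 3 * G ^ 3)) + x\<^sup>2 * (54 * (G * p\<^sup>2 * G ^ 6))"
        for p x G :: "'r::comm_ring_1"
        by (simp add: algebra_simps eval_nat_numeral)
      have "f ^ 12 = (f ^ 3) ^ 4"
        by (simp flip: power_mult)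
      then show ?thesis
        by (simp only: e1 d ring)
    qed
    finally have "sec 1 (dilate 3 (f ^ 3) * Y) = F * (81 * x * F ^ 12 - 12 * P ^ 3 * F ^ 3)"
      unfolding x_def by (metis sec_trisect(2))
    then have "f ^ 3 * sec 1 Y = F * (81 * x * F ^ 12 - 12 * P ^ 3 * F ^ 3)"
      by (simp add: sec_dilate_mult)
    \<comment> \<open>This combination makes f^3 a visible factor: (P F)^3 = f^3 (p + 6t)^3 by
      \<open>e4'\<close>, and the other bracket is f^12 = f^3 (p - 3t)^3 by
      \<open>e2\<close>.\<close>
    also have "\<dots> = F * (- 9 * (P * F) ^ 3 - 3 * ((P ^ 3 - 27 * x * F ^ 9) * F ^ 3))"
    proof -
      have ring: "81 * x * F ^ 12 - 12 * P ^ 3 * F ^ 3 = - 9 * (P * F) ^ 3 - 3 * ((P ^ 3 - 27 * x * F ^ 9) * F ^ 3)"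
        for P x F :: "'r::comm_ring_1"
        by (simp add: algebra_simps eval_nat_numeral)
      show ?thesis by (simp only: ring)
    qed
    also have "\<dots> = F * (- 9 * (f * (p + 6 * t)) ^ 3 - 3 * f ^ 12)"
      by (simp only: e2 e4')
    also have "f ^ 12 = f ^ 3 * (f ^ 3) ^ 3"
      by (simp flip: power_mult power_add)
    also have "F * (- 9 * (f * (p + 6 * t)) ^ 3 - 3 * (f ^ 3 * (f ^ 3) ^ 3))
        = f ^ 3 * (F * (- 9 * (p + 6 * t) ^ 3 - 3 * (p - 3 * t) ^ 3))"
    proof -
      have ring: "F * (- 9 * (a * b) - 3 * (a * c)) = a * (F * (- 9 * b - 3 * c))"
        for F a b c :: "'r::comm_ring_1"
        by (simp add: algebra_simps)
      show ?thesis
        unfolding e1'[symmetric] power_mult_distrib by (rule ring)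
    qed
    finally have "sec 1 Y = F * (- 9 * (p + 6 * t) ^ 3 - 3 * (p - 3 * t) ^ 3)"
      using nz by simp
    \<comment> \<open>The coefficient of p^2 t is -9 * 18 + (-3) * (-9) = -135.\<close>
    also have "\<dots> = dilate 3 (f * (- 12 * P ^ 3 - 1863 * x * F ^ 9)) + x * dilate 3 (- 135 * W)
        + x\<^sup>2 * dilate 3 (- 1053 * (f * P * F ^ 6))"
    proof -
      have ring: "F * (- 9 * (p + 6 * (x * G ^ 3)) ^ 3 - 3 * (p - 3 * (x * G ^ 3)) ^ 3)
        = F * (- 12 * p ^ 3 - 1863 * x ^ 3 * G ^ 9) + x * (- 135 * (F * p\<^sup>2 * G ^ 3))
          + x\<^sup>2 * (- 1053 * (F * p * G ^ 6))"
        for F p x G :: "'r::comm_ring_1"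
        by (simp add: algebra_simps eval_nat_numeral)
      show ?thesis
        by (simp only: W_def d t_def ring)
    qed
    finally have "sec 1 (sec 1 Y) = - 135 * W"
      unfolding x_def by (metis sec_trisect(2))
    then show ?thesis
      unfolding H f_def[symmetric] Y .
  qed
  ultimately show ?thesis
    by (rule that)
qed

section \<open>Generating functions of regular partitions\<close>

definition parts_in :: "nat set \<Rightarrow> nat \<Rightarrow> nat multiset set" where
  "parts_in S n = {\<alpha>. set_mset \<alpha> \<subseteq> S \<and> sum_mset \<alpha> = n}"

definition parts_gf :: "nat set \<Rightarrow> int fps" where
  "parts_gf S = Abs_fps (\<lambda>n. int (card (parts_in S n)))"

lemma finite_parts_in: "0 \<notin> S \<Longrightarrow> finite (parts_in S n)"
  by (rule finite_subset[OF _ finite_partitions_le[of n]])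
    (auto simp: parts_in_def is_partition_def intro!: Nat.gr0I)

lemma parts_in_empty: "parts_in {} n = (if n = 0 then {{#}} else {})"
  by (auto simp: parts_in_def)

lemma parts_in_insert:
  assumes "x \<notin> S"
  shows "parts_in (insert x S) n =
    parts_in S n \<union> (if x \<le> n then add_mset x ` parts_in (insert x S) (n - x) else {})"
proof (intro equalityI subsetI)
  fix \<alpha> assume \<alpha>: "\<alpha> \<in> parts_in (insert x S) n"
  show "\<alpha> \<in> parts_in S n \<union> (if x \<le> n then add_mset x ` parts_in (insert x S) (n - x) else {})"
  proof (cases "x \<in># \<alpha>")
    case True
    then obtain \<beta> where "\<alpha> = add_mset x \<beta>"
      by (metis mset_add)
    then show ?thesis
      using \<alpha> by (auto simp: parts_in_def)
  next
    case False
    then show ?thesis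
      using \<alpha> by (auto simp: parts_in_def)
  qed
next
  fix \<alpha> assume "\<alpha> \<in> parts_in S n \<union> (if x \<le> n then add_mset x ` parts_in (insert x S) (n - x) else {})"
  then show "\<alpha> \<in> parts_in (insert x S) n"
    by (auto simp: parts_in_def split: if_splits)
qed

text \<open>A multiset with parts in \<open>insert x S\<close> either avoids x or arises by adding
  one x to such a multiset of sum n - x.\<close>

lemma parts_gf_insert:
  assumes "x \<notin> S" "0 \<notin> S" "x > 0"
  shows "(1 - fps_X ^ x) * parts_gf (insert x S) = parts_gf S"
proof (rule fps_ext)
  fix n
  have "card (parts_in (insert x S) n) =
      card (parts_in S n) + (if x \<le> n then card (parts_in (insert x S) (n - x)) else 0)"
  proof (subst parts_in_insert[OF assms(1)], subst card_Un_disjoint)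
    show "finite (parts_in S n)"
      using assms by (intro finite_parts_in)
    show "finite (if x \<le> n then add_mset x ` parts_in (insert x S) (n - x) else {})"
      using assms by (simp add: finite_parts_in)
    show "parts_in S n \<inter> (if x \<le> n then add_mset x ` parts_in (insert x S) (n - x) else {}) = {}"
    proof -
      have "add_mset x \<beta> \<notin> parts_in S n" for \<beta>
        using assms(1) by (simp add: parts_in_def)
      then show ?thesis by auto
    qed
    have "inj_on (add_mset x) A" for A
      by (auto intro: inj_onI)
    then show "card (parts_in S n) + card (if x \<le> n then add_mset x ` parts_in (insert x S) (n - x) else {})
        = card (parts_in S n) + (if x \<le> n then card (parts_in (insert x S) (n - x)) else 0)"
      by (simp add: card_image)
  qed
  then show "fps_nth ((1 - fps_X ^ x) * parts_gf (insert x S)) n = fps_nth (parts_gf S) n"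
    by (simp add: parts_gf_def left_diff_distrib fps_X_power_mult_nth)
qed

lemma parts_gf_prod:
  assumes "finite S" "0 \<notin> S"
  shows "(\<Prod>x\<in>S. 1 - fps_X ^ x) * parts_gf S = 1"
  using assms
proof (induction S rule: finite_induct)
  case empty
  show ?case
    by (auto simp: fps_eq_iff parts_gf_def parts_in_empty)
next
  case (insert x S)
  then have gf: "(1 - fps_X ^ x) * parts_gf (insert x S) = parts_gf S"
    by (intro parts_gf_insert) auto
  have "(\<Prod>x\<in>insert x S. 1 - fps_X ^ x) * parts_gf (insert x S)
      = (\<Prod>x\<in>S. 1 - fps_X ^ x) * ((1 - fps_X ^ x) * parts_gf (insert x S))"
    unfolding prod.insert[OF insert.hyps] by (simp only: mult_ac)
  also have "\<dots> = 1"
    unfolding gf using insert by simp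
  finally show ?case .
qed

definition regular_partitions :: "nat \<Rightarrow> nat \<Rightarrow> nat multiset set" where
  "regular_partitions s n = {\<alpha>. is_partition \<alpha> \<and> regular s \<alpha> \<and> sum_mset \<alpha> = n}"

definition regular_gf :: "nat \<Rightarrow> int fps" where
  "regular_gf s = Abs_fps (\<lambda>n. int (card (regular_partitions s n)))"

lemma finite_regular_partitions: "finite (regular_partitions s n)"
  by (rule finite_subset[OF _ finite_partitions_le[of n]]) (auto simp: regular_partitions_def)

lemma regular_gf_eq_upto:
  assumes "n \<le> N"
  shows "eq_upto n (regular_gf s) (parts_gf {m \<in> {1..N}. \<not> s dvd m})"
proof -
  have "regular_partitions s k = parts_in {m \<in> {1..N}. \<not> s dvd m} k" if "k \<le> n" for k
  proof (intro equalityI subsetI)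
    fix \<alpha> assume \<alpha>: "\<alpha> \<in> regular_partitions s k"
    have "p \<le> N" if "p \<in># \<alpha>" for p
      using partition_part_le[OF that] \<alpha> \<open>k \<le> n\<close> assms by (simp add: regular_partitions_def)
    with \<alpha> show "\<alpha> \<in> parts_in {m \<in> {1..N}. \<not> s dvd m} k"
      by (auto simp: regular_partitions_def parts_in_def is_partition_def regular_def Suc_le_eq)
  next
    fix \<alpha> assume "\<alpha> \<in> parts_in {m \<in> {1..N}. \<not> s dvd m} k"
    then show "\<alpha> \<in> regular_partitions s k"
      by (fastforce simp: regular_partitions_def parts_in_def is_partition_def regular_def)
  qed
  then show ?thesis
    by (simp add: eq_upto_def regular_gf_def parts_gf_def)
qed

lemma q_fact_split:
  assumes "s > 0"
  shows "q_fact (s * M) = (\<Prod>m \<in> {m \<in> {1..s * M}. \<not> s dvd m}. 1 - fps_X ^ m) * dilate s (q_fact M)"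
proof -
  have "q_fact (s * M) = (\<Prod>m \<in> {m \<in> {1..s * M}. \<not> s dvd m}. 1 - fps_X ^ m)
      * (\<Prod>m \<in> {m \<in> {1..s * M}. s dvd m}. 1 - fps_X ^ m)"
    unfolding q_fact_def by (subst prod.union_disjoint[symmetric]) (auto intro!: prod.cong)
  also have "(\<Prod>m \<in> {m \<in> {1..s * M}. s dvd m}. 1 - fps_X ^ m) = (\<Prod>m \<in> {1..M}. 1 - fps_X ^ (s * m) :: int fps)"
    using assms
    by (intro prod.reindex_bij_witness[of _ "\<lambda>m. s * m" "\<lambda>m. m div s"]) (auto simp: Suc_le_eq)
  also have "\<dots> = dilate s (q_fact M)"
    unfolding q_fact_def dilate_prod[OF assms]
    using assms by (intro prod.cong) (simp_all only: dilate_diff dilate_1 dilate_X_power)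
  finally show ?thesis .
qed

text \<open>The generating function cancels the factors of f_1 whose exponents are prime to
  divisibility by s, leaving f_s. Truncating at s * n lets the multiples of s form exactly
  \<open>dilate s (q_fact n)\<close>.\<close>

lemma regular_gf_euler:
  assumes "s > 0"
  shows "euler * regular_gf s = dilate s euler"
proof (rule fps_eqI_upto)
  fix n
  define S where "S = {m \<in> {1..s * n}. \<not> s dvd m}"
  have n: "n \<le> s * n"
    using assms by simp
  have "eq_upto n (euler * regular_gf s) (q_fact (s * n) * parts_gf S)"
    unfolding S_def by (intro eq_upto_mult euler_eq_upto regular_gf_eq_upto n)
  also have "q_fact (s * n) * parts_gf S = ((\<Prod>m\<in>S. 1 - fps_X ^ m) * parts_gf S) * dilate s (q_fact n)"
    unfolding q_fact_split[OF assms] S_def by (simp only: mult_ac)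
  also have "(\<Prod>m\<in>S. 1 - fps_X ^ m) * parts_gf S = 1"
    by (rule parts_gf_prod) (auto simp: S_def)
  also have "eq_upto n (1 * dilate s (q_fact n)) (dilate s euler)"
    using assms by (simp add: eq_upto_dilate eq_upto_sym euler_eq_upto)
  finally show "eq_upto n (euler * regular_gf s) (dilate s euler)" .
qed

lemma B_gf: "int (B s t n) = fps_nth (regular_gf s * regular_gf t) n"
proof -
  have "regular_bipartitions s t n = (\<Union>i\<in>{0..n}. regular_partitions s i \<times> regular_partitions t (n - i))"
    by (auto simp: regular_bipartitions_def regular_partitions_def)
  then have "B s t n = (\<Sum>i=0..n. card (regular_partitions s i \<times> regular_partitions t (n - i)))"
    unfolding B_def
    by (simp only:, intro card_UN_disjoint)
      (auto simp: finite_regular_partitions, auto simp: regular_partitions_def)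
  then show ?thesis
    by (simp add: fps_mult_nth regular_gf_def card_cartesian_product)
qed

section \<open>Reduction modulo 11\<close>

lemma freshman_11:
  fixes x :: "'a::comm_ring_1"
  shows "\<exists>e. (1 - x) ^ 11 = 1 - x ^ 11 + 11 * e"
proof
  \<comment> \<open>The coefficients of the witness are the signed binomial coefficients of 11
    divided by 11.\<close>
  show "(1 - x) ^ 11 = 1 - x ^ 11 + 11 * (- x + 5 * x ^ 2 - 15 * x ^ 3 + 30 * x ^ 4 - 42 * x ^ 5
      + 42 * x ^ 6 - 30 * x ^ 7 + 15 * x ^ 8 - 5 * x ^ 9 + x ^ 10)"
    by (simp add: algebra_simps eval_nat_numeral)
qed

lemma q_fact_power_11: "\<exists>e. q_fact n ^ 11 = dilate 11 (q_fact n) + 11 * e"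
proof (induction n)
  case 0
  show ?case by (auto intro: exI[of _ 0])
next
  case (Suc n)
  then obtain e where e: "q_fact n ^ 11 = dilate 11 (q_fact n) + 11 * e" by blast
  define x where "x = (fps_X :: int fps) ^ Suc n"
  obtain e' where e': "(1 - x) ^ 11 = 1 - x ^ 11 + 11 * e'"
    using freshman_11 by blast
  have d: "dilate 11 (q_fact (Suc n)) = dilate 11 (q_fact n) * (1 - x ^ 11)"
    unfolding q_fact_Suc x_def[symmetric]
    by (simp add: dilate_mult dilate_diff x_def dilate_power dilate_X del: power_Suc
        flip: power_mult)
  have ring: "(d + 11 * e) * (y + 11 * e') = d * y + 11 * (d * e' + e * y + 11 * (e * e'))"
    for d e y e' :: "'r::comm_ring_1"
    by (simp add: algebra_simps)
  have "q_fact (Suc n) ^ 11 = dilate 11 (q_fact (Suc n))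
      + 11 * (dilate 11 (q_fact n) * e' + e * (1 - x ^ 11) + 11 * (e * e'))"
    unfolding d unfolding q_fact_Suc x_def[symmetric] power_mult_distrib e e' ring ..
  then show ?case by blast
qed

lemma euler_power_11: "\<exists>e. euler ^ 11 = dilate 11 euler + 11 * e"
proof -
  \<comment> \<open>The error series of \<open>q_fact_power_11\<close> varies with n, so
    divisibility is shown coefficientwise and one quotient series is assembled afterwards.\<close>
  have "11 dvd fps_nth (euler ^ 11 - dilate 11 euler) n" for n
  proof -
    obtain e where "q_fact n ^ 11 = dilate 11 (q_fact n) + 11 * e"
      using q_fact_power_11 by blast
    then have "q_fact n ^ 11 - dilate 11 (q_fact n) = fps_const 11 * e"
      by (simp add: numeral_fps_const)
    moreover have "eq_upto n (euler ^ 11 - dilate 11 euler) (q_fact n ^ 11 - dilate 11 (q_fact n))"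
      by (intro eq_upto_diff eq_upto_power eq_upto_dilate euler_eq_upto) auto
    ultimately show ?thesis
      by (simp add: eq_upto_def del: fps_const_mult)
  qed
  then have "euler ^ 11 - dilate 11 euler
      = fps_const 11 * Abs_fps (\<lambda>n. fps_nth (euler ^ 11 - dilate 11 euler) n div 11)"
    by (intro fps_ext) (simp only: fps_mult_left_const_nth Abs_fps_inverse fps_nth_Abs_fps dvd_mult_div_cancel)
  then show ?thesis
    by (metis add.commute diff_add_cancel numeral_fps_const)
qed

text \<open>Replace f_11 by f^11 in f_27 f_11 / f^2; the series v, inverse to f^2, performs the
  division over the integers.\<close>

lemma B_27_11_cong: "[int (B 27 11 n) = fps_nth (euler ^ 9 * dilate 27 euler) n] (mod 11)"
proof -
  define H where "H = dilate 27 euler"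
  obtain e where e: "euler ^ 11 = dilate 11 euler + 11 * e"
    using euler_power_11 by blast
  obtain v where v: "euler\<^sup>2 * v = 1"
    using fps_right_inverse[of "euler\<^sup>2" 1] by (auto simp: fps_power_zeroth)
  have "euler\<^sup>2 * (regular_gf 27 * regular_gf 11) = (euler * regular_gf 27) * (euler * regular_gf 11)"
    by (simp only: power2_eq_square mult_ac)
  also have "\<dots> = H * (euler ^ 11 - 11 * e)"
    unfolding regular_gf_euler[OF zero_less_numeral] H_def e by simp
  also have "\<dots> = euler\<^sup>2 * (euler ^ 9 * H) - 11 * (H * e)"
    by (simp add: algebra_simps flip: power_add)
  finally have "v * (euler\<^sup>2 * (regular_gf 27 * regular_gf 11)) = v * (euler\<^sup>2 * (euler ^ 9 * H) - 11 * (H * e))"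
    by (rule arg_cong)
  moreover have inv: "v * (euler\<^sup>2 * g) = g" for g
    using v by (metis mult.assoc mult.commute mult_1)
  ultimately have "regular_gf 27 * regular_gf 11 = euler ^ 9 * H - v * (11 * (H * e))"
    by (simp only: right_diff_distrib inv)
  also have "v * (11 * (H * e)) = fps_const 11 * (v * (H * e))"
    by (simp only: numeral_fps_const mult.left_commute)
  finally have "regular_gf 27 * regular_gf 11 = euler ^ 9 * H - fps_const 11 * (v * (H * e))" .
  then have "int (B 27 11 n) = fps_nth (euler ^ 9 * H) n - 11 * fps_nth (v * (H * e)) n"
    unfolding B_gf by (simp del: fps_const_mult)
  then show ?thesis
    by (simp add: H_def cong_iff_dvd_diff)
qed

text \<open>At these indices the coefficients of f^9 f_27 are zero as integers; the modulus enters
  through \<open>B_27_11_cong\<close>.\<close>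

theorem theorem1p3:
  fixes n m :: nat
  assumes "m \<ge> 4"
  shows "[B 27 11 (3 ^ m * n + (5 * 3 ^ (m - 1) - 3) div 2) = 0] (mod 11)"
proof -
  obtain W :: "int fps" where W2: "sec 2 W = 0" and W1: "sec 1 W = 9 * W"
    and W: "sec 1 (sec 1 (sec 0 (euler ^ 9 * dilate 27 euler))) = - 135 * W"
    by (rule W_exists)
  \<comment> \<open>For j = 0 the index is 3n+2. Raising j by one sends an index k to 3k+1, where W
    has 9 times its coefficient at k.\<close>
  have vanish: "fps_nth W (3 ^ Suc j * n + (5 * 3 ^ j - 1) div 2) = 0" for j
  proof (induction j)
    case 0
    show ?case
      using arg_cong[OF W2, of "\<lambda>g. fps_nth g n"] by simp
  next
    case (Suc j)
    define k where "k = 3 ^ Suc j * n + (5 * 3 ^ j - 1) div (2::nat)"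
    have "odd (5 * 3 ^ j :: nat)"
      by simp
    then obtain i where i: "5 * 3 ^ j = 2 * i + (1::nat)"
      by (elim oddE)
    have "fps_nth (sec 1 W) k = fps_nth (9 * W) k"
      by (simp only: W1)
    also have "9 * W = fps_const 9 * W"
      by (simp only: numeral_fps_const)
    finally have "fps_nth W (3 * k + 1) = 9 * fps_nth W k"
      by simp
    moreover have "3 * k + 1 = 3 ^ Suc (Suc j) * n + (5 * 3 ^ Suc j - 1) div 2"
      using i by (simp add: k_def)
    moreover have "fps_nth W k = 0"
      unfolding k_def by (rule Suc.IH)
    ultimately show ?case
      by (metis mult_zero_right)
  qed
  obtain j where j: "m = j + 4"
    using assms by (metis add.commute le_Suc_ex)
  define k where "k = 3 ^ Suc j * n + (5 * 3 ^ j - 1) div (2::nat)"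
  \<comment> \<open>Oddness makes the truncating division by 2 exact, so that the index equals 27k +
    12, the position read by sections 0, 1, 1.\<close>
  have "odd (5 * 3 ^ j :: nat)"
    by simp
  then obtain i where i: "5 * 3 ^ j = 2 * i + (1::nat)"
    by (elim oddE)
  have index: "3 ^ m * n + (5 * 3 ^ (m - 1) - 3) div 2 = 27 * k + 12"
    using i by (simp add: k_def j power_add)
  have "fps_nth (sec 1 (sec 1 (sec 0 (euler ^ 9 * dilate 27 euler)))) k = fps_nth (fps_const (- 135) * W) k"
    unfolding W by (simp only: numeral_fps_const fps_const_neg)
  then have "fps_nth (euler ^ 9 * dilate 27 euler) (27 * k + 12) = 0"
    using vanish[of j, folded k_def] by (simp add: algebra_simps)
  then have "[int (B 27 11 (27 * k + 12)) = int 0] (mod int 11)"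
    using B_27_11_cong[of "27 * k + 12"] by simp
  then show ?thesis
    unfolding index by (simp only: cong_int_iff)
qed

end
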